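(* Let $G$ be a group, let $\Gamma_1$ and $\Gamma_2$ be two $G$-gradings on a Lie algebra $L$ over an arbitrary field, and consider the $G$-graded algebras $L_1=(L,\Gamma_1)$ and $L_2=(L,\Gamma_2)$. If $L_1/\mathfrak{z}(L_1)=L_2/\mathfrak{z}(L_2)$ and $\mathfrak{z}(L_1)=\mathfrak{z}(L_2)$ as $G$-graded algebras, then $L_1\simeq L_2$ as $G$-graded algebras.
   Context: A $G$-grading on a Lie algebra $L$ is a vector space decomposition $L=\bigoplus_{g\in G}L_g$ with $[L_g,L_h]\subset L_{gh}$. $\mathfrak{z}(L)$ is the center of $L$; it is a graded ideal for any $G$-grading, and $\mathfrak{z}(L)$ and $L/\mathfrak{z}(L)$ carry the induced $G$-gradings. Equality "as $G$-graded algebras" means that the gradings induced by $\Gamma_1$ and $\Gamma_2$ coincide. An isomorphism of $G$-graded algebras is an algebra isomorphism preserving degrees. *)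

theory Defs
  imports "HOL-Algebra.Algebra"
begin

text \<open>
  The Lie bracket is the multiplication \<open>\<otimes>\<^bsub>L\<^esub>\<close> of the \<open>module\<close> record, which the locale
  \<open>module\<close> leaves unconstrained; the field \<open>one\<close> of that record has no meaning here.
  The bracket is alternating (not just antisymmetric), as needed in characteristic 2.
\<close>

locale lie_algebra = K?: field K + L?: module K L
  for K :: "('k, 'r) ring_scheme" (structure) and L :: "('k, 'a, 'm) module_scheme" (structure) +
  assumes bracket_closed:
      "\<lbrakk>x \<in> carrier L; y \<in> carrier L\<rbrakk> \<Longrightarrow> x \<otimes>\<^bsub>L\<^esub> y \<in> carrier L"
    and bracket_add_left:
      "\<lbrakk>x \<in> carrier L; y \<in> carrier L; z \<in> carrier L\<rbrakk> \<Longrightarrow>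
        (x \<oplus>\<^bsub>L\<^esub> y) \<otimes>\<^bsub>L\<^esub> z = x \<otimes>\<^bsub>L\<^esub> z \<oplus>\<^bsub>L\<^esub> y \<otimes>\<^bsub>L\<^esub> z"
    and bracket_add_right:
      "\<lbrakk>x \<in> carrier L; y \<in> carrier L; z \<in> carrier L\<rbrakk> \<Longrightarrow>
        z \<otimes>\<^bsub>L\<^esub> (x \<oplus>\<^bsub>L\<^esub> y) = z \<otimes>\<^bsub>L\<^esub> x \<oplus>\<^bsub>L\<^esub> z \<otimes>\<^bsub>L\<^esub> y"
    and bracket_smult_left:
      "\<lbrakk>a \<in> carrier K; x \<in> carrier L; y \<in> carrier L\<rbrakk> \<Longrightarrow>
        (a \<odot>\<^bsub>L\<^esub> x) \<otimes>\<^bsub>L\<^esub> y = a \<odot>\<^bsub>L\<^esub> (x \<otimes>\<^bsub>L\<^esub> y)"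
    and bracket_smult_right:
      "\<lbrakk>a \<in> carrier K; x \<in> carrier L; y \<in> carrier L\<rbrakk> \<Longrightarrow>
        x \<otimes>\<^bsub>L\<^esub> (a \<odot>\<^bsub>L\<^esub> y) = a \<odot>\<^bsub>L\<^esub> (x \<otimes>\<^bsub>L\<^esub> y)"
    and bracket_self:
      "x \<in> carrier L \<Longrightarrow> x \<otimes>\<^bsub>L\<^esub> x = \<zero>\<^bsub>L\<^esub>"
    and jacobi:
      "\<lbrakk>x \<in> carrier L; y \<in> carrier L; z \<in> carrier L\<rbrakk> \<Longrightarrow>
        x \<otimes>\<^bsub>L\<^esub> (y \<otimes>\<^bsub>L\<^esub> z) \<oplus>\<^bsub>L\<^esub> y \<otimes>\<^bsub>L\<^esub> (z \<otimes>\<^bsub>L\<^esub> x) \<oplus>\<^bsub>L\<^esub> z \<otimes>\<^bsub>L\<^esub> (x \<otimes>\<^bsub>L\<^esub> y) = \<zero>\<^bsub>L\<^esub>"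

definition lie_center :: "('k, 'a, 'm) module_scheme \<Rightarrow> 'a set" where
  "lie_center L = {z \<in> carrier L. \<forall>x\<in>carrier L. z \<otimes>\<^bsub>L\<^esub> x = \<zero>\<^bsub>L\<^esub>}"

definition subalg :: "('k, 'a, 'm) module_scheme \<Rightarrow> 'a set \<Rightarrow> ('k, 'a, 'm) module_scheme" where
  "subalg L S = L\<lparr>carrier := S\<rparr>"

text \<open>The quotient \<open>L Quot I\<close> of the library, extended by the scalar multiplication of cosets.\<close>

definition quot_alg :: "('k, 'a, 'm) module_scheme \<Rightarrow> 'a set \<Rightarrow> ('k, 'a set) module" where
  "quot_alg L I =
     ring.extend (L Quot I) (module.fields (\<lambda>a C. \<Union>x\<in>C. I +>\<^bsub>L\<^esub> (a \<odot>\<^bsub>L\<^esub> x)))"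

text \<open>
  A \<open>G\<close>-grading is given by its family of components \<open>\<Gamma> g\<close>; only the values at
  \<open>g \<in> carrier G\<close> matter. That \<open>L\<close> is the direct sum of the components is expressed by
  unique decomposition into finitely supported families.
\<close>

definition direct_decomposition ::
    "'g set \<Rightarrow> ('k, 'a, 'm) module_scheme \<Rightarrow> ('g \<Rightarrow> 'a set) \<Rightarrow> bool" where
  "direct_decomposition I L \<Gamma> \<longleftrightarrow>
     (\<forall>x\<in>carrier L. \<exists>!f. f \<in> (\<Pi>\<^sub>E g\<in>I. \<Gamma> g) \<and>
        finite {g \<in> I. f g \<noteq> \<zero>\<^bsub>L\<^esub>} \<and> x = (\<Oplus>\<^bsub>L\<^esub>g\<in>{g \<in> I. f g \<noteq> \<zero>\<^bsub>L\<^esub>}. f g))"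

definition lie_grading ::
    "('g, 'q) monoid_scheme \<Rightarrow> ('k, 'r) ring_scheme \<Rightarrow> ('k, 'a, 'm) module_scheme \<Rightarrow>
      ('g \<Rightarrow> 'a set) \<Rightarrow> bool" where
  "lie_grading G K L \<Gamma> \<longleftrightarrow>
     (\<forall>g\<in>carrier G. submodule (\<Gamma> g) K L) \<and>
     direct_decomposition (carrier G) L \<Gamma> \<and>
     (\<forall>g\<in>carrier G. \<forall>h\<in>carrier G. \<forall>x\<in>\<Gamma> g. \<forall>y\<in>\<Gamma> h. x \<otimes>\<^bsub>L\<^esub> y \<in> \<Gamma> (g \<otimes>\<^bsub>G\<^esub> h))"

text \<open>The gradings induced on a graded ideal \<open>I\<close> and on the quotient by it.\<close>

definition sub_grading :: "'a set \<Rightarrow> ('g \<Rightarrow> 'a set) \<Rightarrow> 'g \<Rightarrow> 'a set" where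
  "sub_grading I \<Gamma> g = \<Gamma> g \<inter> I"

definition quot_grading ::
    "('k, 'a, 'm) module_scheme \<Rightarrow> 'a set \<Rightarrow> ('g \<Rightarrow> 'a set) \<Rightarrow> 'g \<Rightarrow> 'a set set" where
  "quot_grading L I \<Gamma> g = (\<lambda>x. I +>\<^bsub>L\<^esub> x) ` \<Gamma> g"

definition graded_eq ::
    "('g, 'q) monoid_scheme \<Rightarrow> ('k, 'a, 'm) module_scheme \<times> ('g \<Rightarrow> 'a set) \<Rightarrow>
      ('k, 'a, 'm) module_scheme \<times> ('g \<Rightarrow> 'a set) \<Rightarrow> bool" where
  "graded_eq G A B \<longleftrightarrow> fst A = fst B \<and> (\<forall>g\<in>carrier G. snd A g = snd B g)"

definition alg_iso ::
    "('k, 'r) ring_scheme \<Rightarrow> ('k, 'a, 'm) module_scheme \<Rightarrow> ('k, 'b, 'n) module_scheme \<Rightarrow>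
      ('a \<Rightarrow> 'b) \<Rightarrow> bool" where
  "alg_iso K L M \<phi> \<longleftrightarrow>
     bij_betw \<phi> (carrier L) (carrier M) \<and>
     (\<forall>x\<in>carrier L. \<forall>y\<in>carrier L. \<phi> (x \<oplus>\<^bsub>L\<^esub> y) = \<phi> x \<oplus>\<^bsub>M\<^esub> \<phi> y) \<and>
     (\<forall>a\<in>carrier K. \<forall>x\<in>carrier L. \<phi> (a \<odot>\<^bsub>L\<^esub> x) = a \<odot>\<^bsub>M\<^esub> \<phi> x) \<and>
     (\<forall>x\<in>carrier L. \<forall>y\<in>carrier L. \<phi> (x \<otimes>\<^bsub>L\<^esub> y) = \<phi> x \<otimes>\<^bsub>M\<^esub> \<phi> y)"

definition graded_isomorphic ::
    "('g, 'q) monoid_scheme \<Rightarrow> ('k, 'r) ring_scheme \<Rightarrow>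
      ('k, 'a, 'm) module_scheme \<times> ('g \<Rightarrow> 'a set) \<Rightarrow>
      ('k, 'b, 'n) module_scheme \<times> ('g \<Rightarrow> 'b set) \<Rightarrow> bool" where
  "graded_isomorphic G K A B \<longleftrightarrow>
     (\<exists>\<phi>. alg_iso K (fst A) (fst B) \<phi> \<and> (\<forall>g\<in>carrier G. \<phi> ` snd A g = snd B g))"

end

theory Submission
  imports Defs
begin

text \<open>
  Write \<open>Z\<close> for the center. The required isomorphism moves every element by a central one only.
  A linear map \<open>\<phi>\<close> with \<open>\<phi> x - x \<in> Z\<close> satisfies \<open>[\<phi> x, \<phi> y] = [x, y]\<close>, so it respects the
  bracket precisely when it fixes all brackets. This is compatible with moving \<open>\<Gamma>\<^sub>1 g\<close> onto
  \<open>\<Gamma>\<^sub>2 g\<close> because the two gradings already agree on brackets: as \<open>\<Gamma>\<^sub>1 g\<close> and \<open>\<Gamma>\<^sub>2 g\<close> coincide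
  modulo \<open>Z\<close>, the bracket of \<open>x \<in> \<Gamma>\<^sub>1 g\<close> and \<open>y \<in> \<Gamma>\<^sub>1 h\<close> is also the bracket of an element of
  \<open>\<Gamma>\<^sub>2 g\<close> and one of \<open>\<Gamma>\<^sub>2 h\<close>, and hence lies in \<open>\<Gamma>\<^sub>1 (g h) \<inter> \<Gamma>\<^sub>2 (g h)\<close>. It therefore suffices
  that \<open>\<phi>\<close> fixes every intersection \<open>\<Gamma>\<^sub>1 g \<inter> \<Gamma>\<^sub>2 g\<close>, which contains the degree \<open>g\<close> part of \<open>Z\<close>.

  Such a map comes from two complements of \<open>Z\<close> in \<open>L\<close>. In each degree, take a complement of \<open>Z\<close> in
  \<open>\<Gamma>\<^sub>1 g \<inter> \<Gamma>\<^sub>2 g\<close> and enlarge it both to a complement \<open>P\<^sub>1 g\<close> in \<open>\<Gamma>\<^sub>1 g\<close> and to a complement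
  \<open>P\<^sub>2 g\<close> in \<open>\<Gamma>\<^sub>2 g\<close> (\<open>complement_extending\<close>, by Zorn's lemma). Since the center is a graded
  ideal (\<open>component_center\<close>), these add up to complements \<open>S\<^sub>1\<close> and \<open>S\<^sub>2\<close> of \<open>Z\<close> in \<open>L\<close>
  (\<open>graded_complement_of_center\<close>). The map \<open>\<phi>\<close> is the identity on \<open>Z\<close> and sends an element of
  \<open>S\<^sub>1\<close> to the element of \<open>S\<^sub>2\<close> congruent to it modulo \<open>Z\<close> (\<open>complement_exchange\<close>).
\<close>

section \<open>Complements in vector spaces\<close>

lemma (in module) submodule_zero_closed:
  assumes "submodule H R M"
  shows "\<zero>\<^bsub>M\<^esub> \<in> H"
  using subgroup.one_closed[OF submodule.axioms(1)[OF assms]] by simp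

lemma (in module) zero_submodule: "submodule {\<zero>\<^bsub>M\<^esub>} R M"
  by (rule submoduleI) auto

lemma (in module) submodule_inter:
  assumes "submodule A R M" and "submodule B R M"
  shows "submodule (A \<inter> B) R M"
  using submoduleE[OF assms(1)] submoduleE[OF assms(2)]
    submodule_zero_closed[OF assms(1)] submodule_zero_closed[OF assms(2)]
  by (intro submoduleI) auto

lemma (in module) submodule_adjoin:
  assumes C: "submodule C R M" and x: "x \<in> carrier M"
  shows "submodule {c \<oplus>\<^bsub>M\<^esub> a \<odot>\<^bsub>M\<^esub> x | c a. c \<in> C \<and> a \<in> carrier R} R M" (is "submodule ?D R M")
proof (rule submoduleI)
  note CE = submoduleE[OF C] submodule_zero_closed[OF C]
  have Cc: "c \<in> carrier M" if "c \<in> C" for c using that CE(1) by blast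
  show "?D \<subseteq> carrier M" using Cc x by auto
  show "\<zero>\<^bsub>M\<^esub> \<in> ?D"
    using x CE(7) by (intro CollectI exI[of _ "\<zero>\<^bsub>M\<^esub>"] exI[of _ "\<zero>\<^bsub>R\<^esub>"]) simp
  show "\<ominus>\<^bsub>M\<^esub> u \<in> ?D" if u: "u \<in> ?D" for u
  proof -
    obtain c a where u: "u = c \<oplus>\<^bsub>M\<^esub> a \<odot>\<^bsub>M\<^esub> x" "c \<in> C" "a \<in> carrier R" using u by blast
    have "\<ominus>\<^bsub>M\<^esub> u = \<ominus>\<^bsub>M\<^esub> c \<oplus>\<^bsub>M\<^esub> (\<ominus>\<^bsub>R\<^esub> a) \<odot>\<^bsub>M\<^esub> x"
      using u x Cc by (simp add: M.minus_add smult_l_minus)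
    then show ?thesis using u CE(3) R.a_inv_closed by blast
  qed
  show "u \<oplus>\<^bsub>M\<^esub> v \<in> ?D" if uv: "u \<in> ?D" "v \<in> ?D" for u v
  proof -
    obtain c a where u: "u = c \<oplus>\<^bsub>M\<^esub> a \<odot>\<^bsub>M\<^esub> x" "c \<in> C" "a \<in> carrier R" using uv by blast
    obtain d b where v: "v = d \<oplus>\<^bsub>M\<^esub> b \<odot>\<^bsub>M\<^esub> x" "d \<in> C" "b \<in> carrier R" using uv by blast
    have "u \<oplus>\<^bsub>M\<^esub> v = (c \<oplus>\<^bsub>M\<^esub> d) \<oplus>\<^bsub>M\<^esub> (a \<oplus>\<^bsub>R\<^esub> b) \<odot>\<^bsub>M\<^esub> x"
      using u v x Cc by (simp add: smult_l_distr M.a_ac)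
    then show ?thesis using u v CE(5) R.a_closed by blast
  qed
  show "b \<odot>\<^bsub>M\<^esub> u \<in> ?D" if b: "b \<in> carrier R" and u: "u \<in> ?D" for b u
  proof -
    obtain c a where u: "u = c \<oplus>\<^bsub>M\<^esub> a \<odot>\<^bsub>M\<^esub> x" "c \<in> C" "a \<in> carrier R" using u by blast
    have "b \<odot>\<^bsub>M\<^esub> u = b \<odot>\<^bsub>M\<^esub> c \<oplus>\<^bsub>M\<^esub> (b \<otimes>\<^bsub>R\<^esub> a) \<odot>\<^bsub>M\<^esub> x"
      using u x b Cc by (simp add: smult_r_distr smult_assoc1)
    then show ?thesis using u b CE(4) R.m_closed by blast
  qed
qed

lemma (in module) submodule_Union_chain:
  assumes ne: "\<C> \<noteq> {}"
    and sub: "\<And>C. C \<in> \<C> \<Longrightarrow> submodule C R M"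
    and ch: "\<And>C D. \<lbrakk>C \<in> \<C>; D \<in> \<C>\<rbrakk> \<Longrightarrow> C \<subseteq> D \<or> D \<subseteq> C"
  shows "submodule (\<Union>\<C>) R M"
proof (rule submoduleI)
  show "\<Union>\<C> \<subseteq> carrier M" using submoduleE(1)[OF sub] by blast
  show "\<zero>\<^bsub>M\<^esub> \<in> \<Union>\<C>" using ne submodule_zero_closed[OF sub] by blast
  show "\<ominus>\<^bsub>M\<^esub> u \<in> \<Union>\<C>" if "u \<in> \<Union>\<C>" for u using that submoduleE(3)[OF sub] by blast
  show "b \<odot>\<^bsub>M\<^esub> u \<in> \<Union>\<C>" if "b \<in> carrier R" "u \<in> \<Union>\<C>" for b u
    using that submoduleE(4)[OF sub] by blast
  show "u \<oplus>\<^bsub>M\<^esub> v \<in> \<Union>\<C>" if uv: "u \<in> \<Union>\<C>" "v \<in> \<Union>\<C>" for u v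
  proof -
    obtain C where "C \<in> \<C>" "u \<in> C" "v \<in> C" using uv ch by blast
    then show ?thesis using submoduleE(5)[OF sub] by blast
  qed
qed

text \<open>
  For submodules \<open>B\<close> and \<open>V\<close>, the witness \<open>b\<close> lies in \<open>V\<close> as well, so \<open>C\<close> is a complement of \<open>B \<inter> V\<close> in \<open>V\<close>.
  Keeping \<open>B\<close> instead of \<open>B \<inter> V\<close> lets a single \<open>B\<close>, such as the center, serve for many \<open>V\<close>.
\<close>

definition (in module) complement_in :: "'c set \<Rightarrow> 'c set \<Rightarrow> 'c set \<Rightarrow> bool" where
  "complement_in B V C \<longleftrightarrow> submodule C R M \<and> C \<subseteq> V \<and> C \<inter> B \<subseteq> {\<zero>\<^bsub>M\<^esub>} \<and>
     (\<forall>x\<in>V. \<exists>c\<in>C. \<exists>b\<in>B. x = c \<oplus>\<^bsub>M\<^esub> b)"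

lemma (in module) complement_inD:
  assumes "complement_in B V C"
  shows "submodule C R M" and "C \<subseteq> V" and "C \<inter> B \<subseteq> {\<zero>\<^bsub>M\<^esub>}"
    and "x \<in> V \<Longrightarrow> \<exists>c\<in>C. \<exists>b\<in>B. x = c \<oplus>\<^bsub>M\<^esub> b"
  using assms unfolding complement_in_def by blast+

text \<open>
  A submodule \<open>C\<close> that is maximal among those containing \<open>A\<close>, contained in \<open>V\<close> and meeting \<open>B\<close>
  trivially works: if \<open>x \<in> V\<close> lay outside \<open>C + B\<close>, then \<open>C + R x\<close> would still meet \<open>B\<close> trivially,
  because \<open>c + a x \<in> B\<close> with \<open>a\<close> invertible puts \<open>x\<close> into \<open>C + B\<close>.
\<close>

lemma (in module) complement_extending:
  assumes fld: "field R"
    and A: "submodule A R M" and B: "submodule B R M" and V: "submodule V R M"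
    and AV: "A \<subseteq> V" and AB: "A \<inter> B \<subseteq> {\<zero>\<^bsub>M\<^esub>}"
  obtains C where "A \<subseteq> C" "complement_in B V C"
proof -
  define \<A> where "\<A> = {C. submodule C R M \<and> A \<subseteq> C \<and> C \<subseteq> V \<and> C \<inter> B \<subseteq> {\<zero>\<^bsub>M\<^esub>}}"
  have "\<exists>C\<in>\<A>. \<forall>D\<in>\<A>. C \<subseteq> D \<longrightarrow> D = C"
  proof (rule subset_Zorn_nonempty)
    show "\<A> \<noteq> {}" using A AV AB by (auto simp: \<A>_def)
    fix \<C> assume "\<C> \<noteq> {}" and ch: "subset.chain \<A> \<C>"
    moreover have "\<C> \<subseteq> \<A>" using ch by (simp add: subset.chain_def)
    moreover have "C \<subseteq> D \<or> D \<subseteq> C" if "C \<in> \<C>" "D \<in> \<C>" for C D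
      using ch that by (auto simp: subset_chain_def)
    ultimately have "submodule (\<Union>\<C>) R M"
      by (intro submodule_Union_chain) (auto simp: \<A>_def)
    then show "\<Union>\<C> \<in> \<A>"
      using \<open>\<C> \<noteq> {}\<close> \<open>\<C> \<subseteq> \<A>\<close> by (fastforce simp: \<A>_def)
  qed
  then obtain C where CA: "C \<in> \<A>" and max: "\<And>D. D \<in> \<A> \<Longrightarrow> C \<subseteq> D \<Longrightarrow> D = C" by blast
  have C: "submodule C R M" "A \<subseteq> C" "C \<subseteq> V" "C \<inter> B \<subseteq> {\<zero>\<^bsub>M\<^esub>}" using CA by (auto simp: \<A>_def)
  note CE = submoduleE[OF C(1)] submodule_zero_closed[OF C(1)]
  note BE = submoduleE[OF B] submodule_zero_closed[OF B]
  note VE = submoduleE[OF V]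
  have Cc: "c \<in> carrier M" if "c \<in> C" for c using that CE(1) by blast
  have Bc: "b \<in> carrier M" if "b \<in> B" for b using that BE(1) by blast
  have "\<exists>c\<in>C. \<exists>b\<in>B. x = c \<oplus>\<^bsub>M\<^esub> b" if xV: "x \<in> V" for x
  proof (rule ccontr)
    assume no: "\<not> ?thesis"
    have x: "x \<in> carrier M" using xV VE(1) by blast
    define D where "D = {c \<oplus>\<^bsub>M\<^esub> a \<odot>\<^bsub>M\<^esub> x | c a. c \<in> C \<and> a \<in> carrier R}"
    have "D \<inter> B \<subseteq> {\<zero>\<^bsub>M\<^esub>}"
    proof
      fix b assume "b \<in> D \<inter> B"
      then obtain c a where b: "b = c \<oplus>\<^bsub>M\<^esub> a \<odot>\<^bsub>M\<^esub> x" "c \<in> C" "a \<in> carrier R" "b \<in> B"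
        unfolding D_def by blast
      show "b \<in> {\<zero>\<^bsub>M\<^esub>}"
      proof (cases "a = \<zero>\<^bsub>R\<^esub>")
        case True
        then have "b = c" using b x Cc by simp
        then show ?thesis using b C(4) by blast
      next
        case False
        then have "a \<in> Units R" using b(3) field.field_Units[OF fld] by blast
        then have i: "inv\<^bsub>R\<^esub> a \<in> carrier R" "inv\<^bsub>R\<^esub> a \<otimes>\<^bsub>R\<^esub> a = \<one>\<^bsub>R\<^esub>" by simp_all
        \<comment> \<open>Solving \<open>b = c + a x\<close> for \<open>x\<close> places \<open>x\<close> in \<open>C + B\<close>.\<close>
        have "a \<odot>\<^bsub>M\<^esub> x = \<ominus>\<^bsub>M\<^esub> c \<oplus>\<^bsub>M\<^esub> b"
          using b x Cc by (simp add: M.r_neg1)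
        then have "x = inv\<^bsub>R\<^esub> a \<odot>\<^bsub>M\<^esub> (\<ominus>\<^bsub>M\<^esub> c \<oplus>\<^bsub>M\<^esub> b)"
          using i b x by (metis smult_assoc1 smult_one)
        also have "\<dots> = inv\<^bsub>R\<^esub> a \<odot>\<^bsub>M\<^esub> (\<ominus>\<^bsub>M\<^esub> c) \<oplus>\<^bsub>M\<^esub> inv\<^bsub>R\<^esub> a \<odot>\<^bsub>M\<^esub> b"
          using i b Cc Bc by (intro smult_r_distr) auto
        finally have False using no i(1) CE(3,4) BE(4) b(2,4) by blast
        then show ?thesis ..
      qed
    qed
    moreover have "C \<subseteq> D"
    proof
      fix c assume "c \<in> C"
      moreover have "c = c \<oplus>\<^bsub>M\<^esub> \<zero>\<^bsub>R\<^esub> \<odot>\<^bsub>M\<^esub> x" using \<open>c \<in> C\<close> Cc x by simp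
      ultimately show "c \<in> D" unfolding D_def by blast
    qed
    moreover have "D \<subseteq> V" unfolding D_def using C(3) VE(4,5) xV by blast
    moreover have "submodule D R M" unfolding D_def by (rule submodule_adjoin[OF C(1) x])
    ultimately have "D = C" using max[of D] C(2) by (auto simp: \<A>_def)
    moreover have "x = \<zero>\<^bsub>M\<^esub> \<oplus>\<^bsub>M\<^esub> \<one>\<^bsub>R\<^esub> \<odot>\<^bsub>M\<^esub> x" using x by simp
    ultimately have "x \<in> C" unfolding D_def using CE(7) R.one_closed by blast
    moreover have "x = x \<oplus>\<^bsub>M\<^esub> \<zero>\<^bsub>M\<^esub>" using x by simp
    ultimately show False using no BE(7) by blast
  qed
  then have "complement_in B V C" using C unfolding complement_in_def by blast
  then show thesis using C(2) that by blast
qed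

section \<open>Exchanging one complement for another\<close>

text \<open>
  The graph of the map \<open>p + z \<mapsto> q + z\<close> on \<open>P + Z\<close>, where \<open>q\<close> is the element of \<open>Q\<close> congruent to
  \<open>p\<close> modulo \<open>Z\<close>. The converse of this relation is the same one with \<open>P\<close> and \<open>Q\<close> interchanged
  (for a submodule \<open>Z\<close>), so every statement about the map yields one about its inverse.
\<close>

definition complement_exchange ::
    "('k, 'a, 'm) module_scheme \<Rightarrow> 'a set \<Rightarrow> 'a set \<Rightarrow> 'a set \<Rightarrow> 'a \<Rightarrow> 'a \<Rightarrow> bool" where
  "complement_exchange M Z P Q x y \<longleftrightarrow>
     (\<exists>p\<in>P. \<exists>q\<in>Q. \<exists>z\<in>Z. \<exists>w\<in>Z. x = p \<oplus>\<^bsub>M\<^esub> z \<and> y = q \<oplus>\<^bsub>M\<^esub> z \<and> q = p \<oplus>\<^bsub>M\<^esub> w)"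

locale two_complements = module R M
  for R :: "('k, 'r) ring_scheme" (structure) and M :: "('k, 'a, 'm) module_scheme" (structure) +
  fixes Z P Q :: "'a set"
  assumes Z: "submodule Z R M"
    and compl_P: "complement_in Z (carrier M) P" and compl_Q: "complement_in Z (carrier M) Q"
begin

lemmas P = complement_inD(1)[OF compl_P] and PZ = complement_inD(3)[OF compl_P]
  and P_span = complement_inD(4)[OF compl_P]
lemmas Q = complement_inD(1)[OF compl_Q] and QZ = complement_inD(3)[OF compl_Q]
  and Q_span = complement_inD(4)[OF compl_Q]

lemma in_carrier:
  shows "z \<in> Z \<Longrightarrow> z \<in> carrier M"
    and "p \<in> P \<Longrightarrow> p \<in> carrier M"
    and "q \<in> Q \<Longrightarrow> q \<in> carrier M"
  using submoduleE(1)[OF Z] submoduleE(1)[OF P] submoduleE(1)[OF Q] by auto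

abbreviation "exch \<equiv> complement_exchange M Z P Q"

lemma swap: "two_complements R M Z Q P"
  by (intro two_complements.intro two_complements_axioms.intro) (fact module_axioms Z compl_P compl_Q)+

lemma exch_sym: "exch x y \<Longrightarrow> complement_exchange M Z Q P y x"
proof -
  assume "exch x y"
  then obtain p q z w where h: "p \<in> P" "q \<in> Q" "z \<in> Z" "w \<in> Z"
      "x = p \<oplus>\<^bsub>M\<^esub> z" "y = q \<oplus>\<^bsub>M\<^esub> z" "q = p \<oplus>\<^bsub>M\<^esub> w"
    unfolding complement_exchange_def by blast
  moreover have "p = q \<oplus>\<^bsub>M\<^esub> (\<ominus>\<^bsub>M\<^esub> w)"
    using h by (simp add: in_carrier M.a_assoc M.r_neg)
  ultimately show ?thesis
    using submoduleE(3)[OF Z, of w] unfolding complement_exchange_def by blast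
qed

lemma exch_carrier: "exch x y \<Longrightarrow> x \<in> carrier M \<and> y \<in> carrier M"
  unfolding complement_exchange_def using in_carrier M.a_closed by blast

lemma exch_mod_Z:
  assumes "exch x y"
  shows "\<exists>w\<in>Z. y = x \<oplus>\<^bsub>M\<^esub> w"
proof -
  obtain p q z w where h: "p \<in> P" "q \<in> Q" "z \<in> Z" "w \<in> Z"
      "x = p \<oplus>\<^bsub>M\<^esub> z" "y = q \<oplus>\<^bsub>M\<^esub> z" "q = p \<oplus>\<^bsub>M\<^esub> w"
    using assms unfolding complement_exchange_def by blast
  have "p \<in> carrier M" "z \<in> carrier M" "w \<in> carrier M" using h in_carrier by auto
  then have "y = x \<oplus>\<^bsub>M\<^esub> w" unfolding h(5,6,7) by (simp add: M.a_ac)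
  then show ?thesis using h by blast
qed

lemma exch_total:
  assumes x: "x \<in> carrier M"
  shows "\<exists>y. exch x y"
proof -
  obtain p z where p: "p \<in> P" "z \<in> Z" "x = p \<oplus>\<^bsub>M\<^esub> z" using P_span[OF x] by blast
  obtain q w where q: "q \<in> Q" "w \<in> Z" "p = q \<oplus>\<^bsub>M\<^esub> w" using Q_span[of p] p in_carrier by blast
  have "q = p \<oplus>\<^bsub>M\<^esub> (\<ominus>\<^bsub>M\<^esub> w)"
    using q by (simp add: in_carrier M.a_assoc M.r_neg)
  then show ?thesis
    using p q submoduleE(3)[OF Z, of w] unfolding complement_exchange_def by blast
qed

lemma exch_add:
  assumes "exch x y" and "exch x' y'"
  shows "exch (x \<oplus>\<^bsub>M\<^esub> x') (y \<oplus>\<^bsub>M\<^esub> y')"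
proof -
  obtain p q z w where h: "p \<in> P" "q \<in> Q" "z \<in> Z" "w \<in> Z"
      "x = p \<oplus>\<^bsub>M\<^esub> z" "y = q \<oplus>\<^bsub>M\<^esub> z" "q = p \<oplus>\<^bsub>M\<^esub> w"
    using assms(1) unfolding complement_exchange_def by blast
  obtain p' q' z' w' where h': "p' \<in> P" "q' \<in> Q" "z' \<in> Z" "w' \<in> Z"
      "x' = p' \<oplus>\<^bsub>M\<^esub> z'" "y' = q' \<oplus>\<^bsub>M\<^esub> z'" "q' = p' \<oplus>\<^bsub>M\<^esub> w'"
    using assms(2) unfolding complement_exchange_def by blast
  have c: "p \<in> carrier M" "z \<in> carrier M" "w \<in> carrier M"
      "p' \<in> carrier M" "z' \<in> carrier M" "w' \<in> carrier M"
    using h h' in_carrier by auto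
  have "p \<oplus>\<^bsub>M\<^esub> p' \<in> P" "q \<oplus>\<^bsub>M\<^esub> q' \<in> Q" "z \<oplus>\<^bsub>M\<^esub> z' \<in> Z" "w \<oplus>\<^bsub>M\<^esub> w' \<in> Z"
    using h h' submoduleE(5)[OF P] submoduleE(5)[OF Q] submoduleE(5)[OF Z] by auto
  moreover have "x \<oplus>\<^bsub>M\<^esub> x' = (p \<oplus>\<^bsub>M\<^esub> p') \<oplus>\<^bsub>M\<^esub> (z \<oplus>\<^bsub>M\<^esub> z')"
      "y \<oplus>\<^bsub>M\<^esub> y' = (q \<oplus>\<^bsub>M\<^esub> q') \<oplus>\<^bsub>M\<^esub> (z \<oplus>\<^bsub>M\<^esub> z')"
      "q \<oplus>\<^bsub>M\<^esub> q' = (p \<oplus>\<^bsub>M\<^esub> p') \<oplus>\<^bsub>M\<^esub> (w \<oplus>\<^bsub>M\<^esub> w')"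
    using c by (simp_all add: h(5-7) h'(5-7) M.a_ac)
  ultimately show ?thesis unfolding complement_exchange_def by blast
qed

lemma exch_smult:
  assumes a: "a \<in> carrier R" and "exch x y"
  shows "exch (a \<odot>\<^bsub>M\<^esub> x) (a \<odot>\<^bsub>M\<^esub> y)"
proof -
  obtain p q z w where h: "p \<in> P" "q \<in> Q" "z \<in> Z" "w \<in> Z"
      "x = p \<oplus>\<^bsub>M\<^esub> z" "y = q \<oplus>\<^bsub>M\<^esub> z" "q = p \<oplus>\<^bsub>M\<^esub> w"
    using assms(2) unfolding complement_exchange_def by blast
  have c: "p \<in> carrier M" "q \<in> carrier M" "z \<in> carrier M" "w \<in> carrier M"
    using h(1-4) in_carrier by auto
  have "a \<odot>\<^bsub>M\<^esub> p \<in> P" "a \<odot>\<^bsub>M\<^esub> q \<in> Q" "a \<odot>\<^bsub>M\<^esub> z \<in> Z" "a \<odot>\<^bsub>M\<^esub> w \<in> Z"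
    using h(1-4) a submoduleE(4)[OF P] submoduleE(4)[OF Q] submoduleE(4)[OF Z] by auto
  moreover have "a \<odot>\<^bsub>M\<^esub> x = a \<odot>\<^bsub>M\<^esub> p \<oplus>\<^bsub>M\<^esub> a \<odot>\<^bsub>M\<^esub> z" "a \<odot>\<^bsub>M\<^esub> y = a \<odot>\<^bsub>M\<^esub> q \<oplus>\<^bsub>M\<^esub> a \<odot>\<^bsub>M\<^esub> z"
    unfolding h(5,6) using a c by (simp_all add: smult_r_distr)
  moreover have "a \<odot>\<^bsub>M\<^esub> q = a \<odot>\<^bsub>M\<^esub> p \<oplus>\<^bsub>M\<^esub> a \<odot>\<^bsub>M\<^esub> w"
    unfolding h(7) using a c by (simp add: smult_r_distr)
  ultimately show ?thesis unfolding complement_exchange_def by blast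
qed

text \<open>
  By linearity it suffices that \<open>0\<close> is related to \<open>0\<close> alone: if \<open>0 = p + z\<close>, then
  \<open>p = - z \<in> P \<inter> Z\<close>, so \<open>p\<close> and \<open>z\<close> vanish, and then \<open>q \<in> Q \<inter> Z\<close> vanishes too.
\<close>

lemma exch_functional:
  assumes xy: "exch x y" and xy': "exch x y'"
  shows "y = y'"
proof -
  have c: "x \<in> carrier M" "y \<in> carrier M" "y' \<in> carrier M"
    using exch_carrier xy xy' by auto
  have "exch (\<ominus>\<^bsub>M\<^esub> x) (\<ominus>\<^bsub>M\<^esub> y')"
    using exch_smult[OF _ xy', of "\<ominus>\<^bsub>R\<^esub> \<one>\<^bsub>R\<^esub>"] c by (simp add: smult_l_minus)
  from exch_add[OF xy this] have "exch \<zero>\<^bsub>M\<^esub> (y \<oplus>\<^bsub>M\<^esub> (\<ominus>\<^bsub>M\<^esub> y'))"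
    using c by (simp add: M.r_neg)
  then obtain p q z w where h: "p \<in> P" "q \<in> Q" "z \<in> Z" "w \<in> Z"
      "\<zero>\<^bsub>M\<^esub> = p \<oplus>\<^bsub>M\<^esub> z" "y \<oplus>\<^bsub>M\<^esub> (\<ominus>\<^bsub>M\<^esub> y') = q \<oplus>\<^bsub>M\<^esub> z" "q = p \<oplus>\<^bsub>M\<^esub> w"
    unfolding complement_exchange_def by blast
  have d: "p \<in> carrier M" "q \<in> carrier M" "z \<in> carrier M" "w \<in> carrier M"
    using h(1-4) in_carrier by auto
  have "p = \<ominus>\<^bsub>M\<^esub> z" using h(5) d by (metis M.minus_equality)
  then have "p \<in> Z" using submoduleE(3)[OF Z] h by simp
  then have p0: "p = \<zero>\<^bsub>M\<^esub>" using h PZ by blast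
  then have "q = w" using h(7) d by simp
  then have q0: "q = \<zero>\<^bsub>M\<^esub>" using h(2,4) QZ by blast
  have "z = \<zero>\<^bsub>M\<^esub>" using h(5) p0 d by (metis M.l_zero)
  then have "y \<oplus>\<^bsub>M\<^esub> (\<ominus>\<^bsub>M\<^esub> y') = \<zero>\<^bsub>M\<^esub>" using q0 by (simp add: h(6))
  then show ?thesis using c by (metis M.a_inv_closed M.minus_equality M.minus_minus)
qed

lemma exch_refl:
  assumes "p \<in> P" "p \<in> Q" "z \<in> Z"
  shows "exch (p \<oplus>\<^bsub>M\<^esub> z) (p \<oplus>\<^bsub>M\<^esub> z)"
proof -
  have "p = p \<oplus>\<^bsub>M\<^esub> \<zero>\<^bsub>M\<^esub>" using assms in_carrier by simp
  then show ?thesis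
    using assms submodule_zero_closed[OF Z] unfolding complement_exchange_def by blast
qed

text \<open>
  All choices behind the exchange can be made inside \<open>U\<close> and \<open>V\<close>: the \<open>P\<close>-part \<open>p\<close> of \<open>x\<close> lies in \<open>U\<close>,
  so does \<open>z = x - p\<close>, which hence lies in \<open>V\<close>; and \<open>p\<close> is congruent modulo \<open>Z\<close> to an element of
  \<open>V\<close>, whose \<open>Q\<close>-part lies in \<open>V\<close>.
\<close>

lemma exch_part:
  assumes U: "submodule U R M" and V: "submodule V R M" and UZ: "U \<inter> Z \<subseteq> V"
    and U_span: "\<And>x. x \<in> U \<Longrightarrow> \<exists>p\<in>U \<inter> P. \<exists>z\<in>Z. x = p \<oplus>\<^bsub>M\<^esub> z"
    and V_span: "\<And>y. y \<in> V \<Longrightarrow> \<exists>q\<in>V \<inter> Q. \<exists>z\<in>Z. y = q \<oplus>\<^bsub>M\<^esub> z"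
    and UV: "\<And>x. x \<in> U \<Longrightarrow> \<exists>y\<in>V. \<exists>z\<in>Z. x = y \<oplus>\<^bsub>M\<^esub> z"
    and x: "x \<in> U"
  shows "\<exists>y\<in>V. exch x y"
proof -
  obtain p z where p: "p \<in> U" "p \<in> P" "z \<in> Z" "x = p \<oplus>\<^bsub>M\<^esub> z" using U_span[OF x] by blast
  obtain y w where y: "y \<in> V" "w \<in> Z" "p = y \<oplus>\<^bsub>M\<^esub> w" using UV[OF p(1)] by blast
  obtain q v where q: "q \<in> V" "q \<in> Q" "v \<in> Z" "y = q \<oplus>\<^bsub>M\<^esub> v" using V_span[OF y(1)] by blast
  have c: "q \<in> carrier M" "v \<in> carrier M" "w \<in> carrier M" "z \<in> carrier M" "p \<in> carrier M"
    using p q y in_carrier by auto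
  have "z = \<ominus>\<^bsub>M\<^esub> p \<oplus>\<^bsub>M\<^esub> x" using c p(4) by (simp add: M.r_neg1)
  then have "z \<in> U" using submoduleE(3,5)[OF U] p(1) x by simp
  then have "z \<in> V" using UZ p(3) by blast
  then have "q \<oplus>\<^bsub>M\<^esub> z \<in> V" using submoduleE(5)[OF V] q by simp
  moreover have "q = p \<oplus>\<^bsub>M\<^esub> (\<ominus>\<^bsub>M\<^esub> (v \<oplus>\<^bsub>M\<^esub> w))"
    using c by (simp add: y(3) q(4) M.a_assoc M.r_neg)
  moreover have "\<ominus>\<^bsub>M\<^esub> (v \<oplus>\<^bsub>M\<^esub> w) \<in> Z" using submoduleE(3,5)[OF Z] q y by simp
  ultimately show ?thesis using p q unfolding complement_exchange_def by blast
qed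

end

section \<open>Homogeneous components\<close>

locale graded_lie_algebra = lie_algebra K L
  for K :: "('k, 'r) ring_scheme" (structure) and L :: "('k, 'a, 'm) module_scheme" (structure) +
  fixes G :: "('g, 'q) monoid_scheme" and \<Gamma> :: "'g \<Rightarrow> 'a set"
  assumes group_G: "group G" and grading: "lie_grading G K L \<Gamma>"
begin

lemma part_submodule: "g \<in> carrier G \<Longrightarrow> submodule (\<Gamma> g) K L"
  using grading by (simp add: lie_grading_def)

lemma part_carrier: "g \<in> carrier G \<Longrightarrow> x \<in> \<Gamma> g \<Longrightarrow> x \<in> carrier L"
  using submoduleE(1)[OF part_submodule] by blast

lemma bracket_part:
  "\<lbrakk>g \<in> carrier G; h \<in> carrier G; x \<in> \<Gamma> g; y \<in> \<Gamma> h\<rbrakk> \<Longrightarrow> x \<otimes>\<^bsub>L\<^esub> y \<in> \<Gamma> (g \<otimes>\<^bsub>G\<^esub> h)"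
  using grading by (simp add: lie_grading_def)

definition decomposes :: "'a \<Rightarrow> ('g \<Rightarrow> 'a) \<Rightarrow> bool" where
  "decomposes x f \<longleftrightarrow> f \<in> (\<Pi>\<^sub>E g\<in>carrier G. \<Gamma> g) \<and>
     finite {g \<in> carrier G. f g \<noteq> \<zero>\<^bsub>L\<^esub>} \<and> x = (\<Oplus>\<^bsub>L\<^esub>g\<in>{g \<in> carrier G. f g \<noteq> \<zero>\<^bsub>L\<^esub>}. f g)"

definition component :: "'a \<Rightarrow> 'g \<Rightarrow> 'a" where
  "component x = (THE f. decomposes x f)"

lemma ex1_decomposes: "x \<in> carrier L \<Longrightarrow> \<exists>!f. decomposes x f"
  using grading unfolding lie_grading_def direct_decomposition_def decomposes_def by blast

lemma decomposes_component: "x \<in> carrier L \<Longrightarrow> decomposes x (component x)"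
  unfolding component_def by (rule theI'[OF ex1_decomposes])

text \<open>
  Allowing any finite set that carries the support makes decompositions of different elements
  comparable: they can be summed over the union of their supports.
\<close>

lemma component_eqI:
  assumes "finite A" "A \<subseteq> carrier G" "\<And>g. g \<in> carrier G \<Longrightarrow> f g \<in> \<Gamma> g"
    and zero: "\<And>g. g \<in> carrier G - A \<Longrightarrow> f g = \<zero>\<^bsub>L\<^esub>"
    and x: "x = (\<Oplus>\<^bsub>L\<^esub>g\<in>A. f g)" and g: "g \<in> carrier G"
  shows "component x g = f g"
proof -
  define f' where "f' = restrict f (carrier G)"
  have sup: "{g \<in> carrier G. f' g \<noteq> \<zero>\<^bsub>L\<^esub>} \<subseteq> A" using zero by (auto simp: f'_def)
  have fA: "f \<in> A \<rightarrow> carrier L" using assms part_carrier by blast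
  have "x = (\<Oplus>\<^bsub>L\<^esub>g\<in>{g \<in> carrier G. f' g \<noteq> \<zero>\<^bsub>L\<^esub>}. f' g)"
    unfolding x using assms(1,2) sup fA
    by (intro M.add.finprod_mono_neutral_cong_right) (auto simp: f'_def)
  moreover have "finite {g \<in> carrier G. f' g \<noteq> \<zero>\<^bsub>L\<^esub>}"
    using sup assms(1) finite_subset by blast
  moreover have "f' \<in> (\<Pi>\<^sub>E g\<in>carrier G. \<Gamma> g)" using assms by (auto simp: f'_def)
  ultimately have "decomposes x f'" by (simp add: decomposes_def)
  moreover have "x \<in> carrier L" unfolding x using fA by simp
  ultimately have "component x = f'"
    using ex1_decomposes decomposes_component by blast
  then show ?thesis using g by (simp add: f'_def)
qed

lemma component_support:
  assumes "x \<in> carrier L"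
  obtains A where "finite A" "A \<subseteq> carrier G" "x = (\<Oplus>\<^bsub>L\<^esub>g\<in>A. component x g)"
    "\<And>g. g \<in> carrier G - A \<Longrightarrow> component x g = \<zero>\<^bsub>L\<^esub>"
proof (rule that[of "{g \<in> carrier G. component x g \<noteq> \<zero>\<^bsub>L\<^esub>}"])
  show "finite {g \<in> carrier G. component x g \<noteq> \<zero>\<^bsub>L\<^esub>}"
    and "x = (\<Oplus>\<^bsub>L\<^esub>g\<in>{g \<in> carrier G. component x g \<noteq> \<zero>\<^bsub>L\<^esub>}. component x g)"
    using decomposes_component[OF assms] by (simp_all only: decomposes_def)
qed auto

lemma component_part: "\<lbrakk>x \<in> carrier L; g \<in> carrier G\<rbrakk> \<Longrightarrow> component x g \<in> \<Gamma> g"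
  using decomposes_component unfolding decomposes_def by blast

lemma component_carrier: "\<lbrakk>x \<in> carrier L; g \<in> carrier G\<rbrakk> \<Longrightarrow> component x g \<in> carrier L"
  using component_part part_carrier by blast

lemma component_homogeneous:
  assumes h: "h \<in> carrier G" and x: "x \<in> \<Gamma> h" and g: "g \<in> carrier G"
  shows "component x g = (if g = h then x else \<zero>\<^bsub>L\<^esub>)"
proof (rule component_eqI[of "{h}" "\<lambda>g. if g = h then x else \<zero>\<^bsub>L\<^esub>"])
  show "x = (\<Oplus>\<^bsub>L\<^esub>g\<in>{h}. if g = h then x else \<zero>\<^bsub>L\<^esub>)"
    using part_carrier[OF h x] by simp
qed (use assms submodule_zero_closed[OF part_submodule] in auto)

lemma component_add:
  assumes x: "x \<in> carrier L" and y: "y \<in> carrier L" and g: "g \<in> carrier G"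
  shows "component (x \<oplus>\<^bsub>L\<^esub> y) g = component x g \<oplus>\<^bsub>L\<^esub> component y g"
proof -
  obtain A where A: "finite A" "A \<subseteq> carrier G" "x = (\<Oplus>\<^bsub>L\<^esub>g\<in>A. component x g)"
    "\<And>g. g \<in> carrier G - A \<Longrightarrow> component x g = \<zero>\<^bsub>L\<^esub>"
    by (rule component_support[OF x]) blast
  obtain B where B: "finite B" "B \<subseteq> carrier G" "y = (\<Oplus>\<^bsub>L\<^esub>g\<in>B. component y g)"
    "\<And>g. g \<in> carrier G - B \<Longrightarrow> component y g = \<zero>\<^bsub>L\<^esub>"
    by (rule component_support[OF y]) blast
  have cx: "component x \<in> A \<union> B \<rightarrow> carrier L" and cy: "component y \<in> A \<union> B \<rightarrow> carrier L"
    using component_carrier x y A(2) B(2) by blast+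
  have "(\<Oplus>\<^bsub>L\<^esub>g\<in>A. component x g) = (\<Oplus>\<^bsub>L\<^esub>g\<in>A \<union> B. component x g)"
    using A(1,2,4) B(1,2) cx by (intro M.add.finprod_mono_neutral_cong_left) auto
  moreover have "(\<Oplus>\<^bsub>L\<^esub>g\<in>B. component y g) = (\<Oplus>\<^bsub>L\<^esub>g\<in>A \<union> B. component y g)"
    using B(1,2,4) A(1,2) cy by (intro M.add.finprod_mono_neutral_cong_left) auto
  ultimately have "x \<oplus>\<^bsub>L\<^esub> y = (\<Oplus>\<^bsub>L\<^esub>g\<in>A \<union> B. component x g \<oplus>\<^bsub>L\<^esub> component y g)"
    using A(3) B(3) cx cy by (simp add: M.finsum_addf)
  then show ?thesis
    using A B g component_part[OF x] component_part[OF y] submoduleE(5)[OF part_submodule]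
    by (intro component_eqI[of "A \<union> B" "\<lambda>g. component x g \<oplus>\<^bsub>L\<^esub> component y g"]) auto
qed

lemma homogeneous_induct [consumes 1, case_names zero homogeneous add]:
  assumes x: "x \<in> carrier L"
    and zero: "P \<zero>\<^bsub>L\<^esub>"
    and hom: "\<And>g x. \<lbrakk>g \<in> carrier G; x \<in> \<Gamma> g\<rbrakk> \<Longrightarrow> P x"
    and add: "\<And>x y. \<lbrakk>x \<in> carrier L; y \<in> carrier L; P x; P y\<rbrakk> \<Longrightarrow> P (x \<oplus>\<^bsub>L\<^esub> y)"
  shows "P x"
proof -
  obtain A where A: "finite A" "A \<subseteq> carrier G" "x = (\<Oplus>\<^bsub>L\<^esub>g\<in>A. component x g)"
    by (rule component_support[OF x]) blast
  have "P (\<Oplus>\<^bsub>L\<^esub>g\<in>A. component x g)"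
    using A(1,2)
  proof (induction A rule: finite_induct)
    case empty then show ?case using zero by simp
  next
    case (insert g A)
    have c: "component x g \<in> carrier L" "component x \<in> A \<rightarrow> carrier L"
      using insert component_carrier[OF x] by auto
    have "P (component x g)" using hom component_part[OF x] insert by blast
    then have "P (component x g \<oplus>\<^bsub>L\<^esub> (\<Oplus>\<^bsub>L\<^esub>g\<in>A. component x g))"
      using insert c by (intro add) auto
    then show ?case using insert c by simp
  qed
  then show ?thesis using A by simp
qed

lemma component_smult:
  assumes a: "a \<in> carrier K" and x: "x \<in> carrier L" and g: "g \<in> carrier G"
  shows "component (a \<odot>\<^bsub>L\<^esub> x) g = a \<odot>\<^bsub>L\<^esub> component x g"
  using x
proof (induction x rule: homogeneous_induct)
  case zero
  have "\<zero>\<^bsub>L\<^esub> \<in> \<Gamma> g" using g submodule_zero_closed[OF part_submodule] by blast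
  then show ?case using a g component_homogeneous[of g "\<zero>\<^bsub>L\<^esub>" g] by simp
next
  case (homogeneous h x)
  then have "a \<odot>\<^bsub>L\<^esub> x \<in> \<Gamma> h" using a submoduleE(4)[OF part_submodule] by blast
  then show ?case using homogeneous a g component_homogeneous by simp
next
  case (add x y)
  then show ?case using a g component_carrier by (simp add: smult_r_distr component_add)
qed

lemma components_zero:
  assumes x: "x \<in> carrier L" and "\<And>g. g \<in> carrier G \<Longrightarrow> component x g = \<zero>\<^bsub>L\<^esub>"
  shows "x = \<zero>\<^bsub>L\<^esub>"
proof -
  obtain A where A: "finite A" "A \<subseteq> carrier G" "x = (\<Oplus>\<^bsub>L\<^esub>g\<in>A. component x g)"
    by (rule component_support[OF x]) blast
  have "(\<Oplus>\<^bsub>L\<^esub>g\<in>A. component x g) = (\<Oplus>\<^bsub>L\<^esub>g\<in>A. \<zero>\<^bsub>L\<^esub>)"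
    using A assms(2) by (intro M.add.finprod_cong') auto
  then show ?thesis using A by simp
qed

end

section \<open>The center\<close>

context lie_algebra
begin

lemma bracket_zero [simp]:
  assumes "x \<in> carrier L"
  shows "\<zero>\<^bsub>L\<^esub> \<otimes>\<^bsub>L\<^esub> x = \<zero>\<^bsub>L\<^esub>" and "x \<otimes>\<^bsub>L\<^esub> \<zero>\<^bsub>L\<^esub> = \<zero>\<^bsub>L\<^esub>"
  using assms bracket_smult_left[of "\<zero>\<^bsub>K\<^esub>" "\<zero>\<^bsub>L\<^esub>" x] bracket_smult_right[of "\<zero>\<^bsub>K\<^esub>" x "\<zero>\<^bsub>L\<^esub>"]
    bracket_closed by simp_all

lemma center_carrier: "z \<in> lie_center L \<Longrightarrow> z \<in> carrier L"
  by (simp add: lie_center_def)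

lemma center_bracket_left: "\<lbrakk>z \<in> lie_center L; x \<in> carrier L\<rbrakk> \<Longrightarrow> z \<otimes>\<^bsub>L\<^esub> x = \<zero>\<^bsub>L\<^esub>"
  by (simp add: lie_center_def)

lemma center_bracket_right:
  assumes z: "z \<in> lie_center L" and x: "x \<in> carrier L"
  shows "x \<otimes>\<^bsub>L\<^esub> z = \<zero>\<^bsub>L\<^esub>"
proof -
  have c: "z \<in> carrier L" using z by (rule center_carrier)
  have "\<zero>\<^bsub>L\<^esub> = (x \<oplus>\<^bsub>L\<^esub> z) \<otimes>\<^bsub>L\<^esub> (x \<oplus>\<^bsub>L\<^esub> z)" using c x by (simp add: bracket_self)
  also have "\<dots> = x \<otimes>\<^bsub>L\<^esub> (x \<oplus>\<^bsub>L\<^esub> z) \<oplus>\<^bsub>L\<^esub> z \<otimes>\<^bsub>L\<^esub> (x \<oplus>\<^bsub>L\<^esub> z)" using c x by (intro bracket_add_left) auto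
  also have "\<dots> = x \<otimes>\<^bsub>L\<^esub> z"
    using c x z bracket_closed by (simp add: bracket_add_right bracket_self center_bracket_left)
  finally show ?thesis by simp
qed

lemma center_submodule: "submodule (lie_center L) K L"
proof (rule submoduleI)
  show smult: "a \<odot>\<^bsub>L\<^esub> x \<in> lie_center L" if "a \<in> carrier K" "x \<in> lie_center L" for a x
    using that by (auto simp: lie_center_def bracket_smult_left)
  show "\<ominus>\<^bsub>L\<^esub> a \<in> lie_center L" if "a \<in> lie_center L" for a
    using smult[of "\<ominus>\<^bsub>K\<^esub> \<one>\<^bsub>K\<^esub>" a] that by (simp add: smult_l_minus center_carrier)
qed (auto simp: lie_center_def bracket_add_left)

lemma bracket_mod_center:
  assumes "x \<in> carrier L" "y \<in> carrier L" "z \<in> lie_center L" "w \<in> lie_center L"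
  shows "(x \<oplus>\<^bsub>L\<^esub> z) \<otimes>\<^bsub>L\<^esub> (y \<oplus>\<^bsub>L\<^esub> w) = x \<otimes>\<^bsub>L\<^esub> y"
  using assms bracket_closed
  by (simp add: bracket_add_left bracket_add_right center_bracket_left center_bracket_right center_carrier)

end

context graded_lie_algebra
begin

text \<open>
  Bracketing with \<open>y\<close> of degree \<open>h\<close> shifts degrees by \<open>g \<mapsto> gh\<close>; as this is injective,
  no two components of \<open>x\<close> end up in the same degree.
\<close>

lemma component_bracket_homogeneous:
  assumes x: "x \<in> carrier L" and g: "g \<in> carrier G" and h: "h \<in> carrier G" and y: "y \<in> \<Gamma> h"
  shows "component (x \<otimes>\<^bsub>L\<^esub> y) (g \<otimes>\<^bsub>G\<^esub> h) = component x g \<otimes>\<^bsub>L\<^esub> y"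
  using x
proof (induction x rule: homogeneous_induct)
  interpret G: group G by (rule group_G)
  note yc = part_carrier[OF h y]
  {
    case zero
    have "\<zero>\<^bsub>L\<^esub> \<in> \<Gamma> k" if "k \<in> carrier G" for k
      using that submodule_zero_closed[OF part_submodule] by blast
    then show ?case using g h yc by (simp add: component_homogeneous[of g] component_homogeneous[of "g \<otimes>\<^bsub>G\<^esub> h"])
  next
    case (homogeneous k x)
    then have "x \<otimes>\<^bsub>L\<^esub> y \<in> \<Gamma> (k \<otimes>\<^bsub>G\<^esub> h)" using bracket_part h y by blast
    then show ?case
      using homogeneous g h yc by (simp add: component_homogeneous[of k] component_homogeneous[of "k \<otimes>\<^bsub>G\<^esub> h"])
  next
    case (add x x')
    then show ?case
      using g h yc component_carrier by (simp add: bracket_add_left component_add bracket_closed)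
  }
qed

text \<open>
  The bracket of the \<open>g\<close>-component of \<open>z\<close> with any \<open>y\<close> of degree \<open>h\<close> is the \<open>gh\<close>-component of
  \<open>[z, y] = 0\<close>. Hence that component has zero bracket with all homogeneous elements, and these span \<open>L\<close>.
\<close>

lemma component_center:
  assumes z: "z \<in> lie_center L" and g: "g \<in> carrier G"
  shows "component z g \<in> lie_center L"
proof -
  interpret G: group G by (rule group_G)
  have zc: "z \<in> carrier L" using z by (rule center_carrier)
  have "component z g \<otimes>\<^bsub>L\<^esub> y = \<zero>\<^bsub>L\<^esub>" if "y \<in> carrier L" for y
    using that
  proof (induction y rule: homogeneous_induct)
    case zero then show ?case using component_carrier[OF zc g] by simp
  next
    case (homogeneous h y)
    have gh: "g \<otimes>\<^bsub>G\<^esub> h \<in> carrier G" using g homogeneous by simp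
    have "component z g \<otimes>\<^bsub>L\<^esub> y = component \<zero>\<^bsub>L\<^esub> (g \<otimes>\<^bsub>G\<^esub> h)"
      using component_bracket_homogeneous[OF zc g homogeneous] z part_carrier[OF homogeneous]
      by (simp add: center_bracket_left)
    also have "\<dots> = \<zero>\<^bsub>L\<^esub>"
      using component_homogeneous[OF gh _ gh] submodule_zero_closed[OF part_submodule[OF gh]] by simp
    finally show ?case .
  next
    case (add x y) then show ?case using component_carrier[OF zc g] by (simp add: bracket_add_right)
  qed
  then show ?thesis using component_carrier[OF zc g] by (simp add: lie_center_def)
qed

text \<open>
  The complement consists of the elements whose components all lie in the given pieces. It meets the
  center trivially because the components of a central element are again central.
\<close>

lemma graded_complement_of_center:
  assumes P: "\<And>g. g \<in> carrier G \<Longrightarrow> complement_in (lie_center L) (\<Gamma> g) (P g)"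
  obtains S where "complement_in (lie_center L) (carrier L) S" "\<And>g. g \<in> carrier G \<Longrightarrow> P g \<subseteq> S"
proof -
  note P_sub = complement_inD(1)[OF P] and P_part = complement_inD(2)[OF P]
    and PZ = complement_inD(3)[OF P] and span = complement_inD(4)[OF P]
  define S where "S = {x \<in> carrier L. \<forall>g\<in>carrier G. component x g \<in> P g}"
  have P0: "\<zero>\<^bsub>L\<^esub> \<in> P g" if "g \<in> carrier G" for g using submodule_zero_closed[OF P_sub[OF that]] .
  have PS: "P g \<subseteq> S" if g: "g \<in> carrier G" for g
    using P_part[OF g] P0 g component_homogeneous[OF g] part_carrier[OF g] by (auto simp: S_def)
  interpret G: group G by (rule group_G)
  have zS: "\<zero>\<^bsub>L\<^esub> \<in> S" using PS[of "\<one>\<^bsub>G\<^esub>"] P0[of "\<one>\<^bsub>G\<^esub>"] by auto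
  have S: "submodule S K L"
  proof (rule submoduleI)
    show "S \<subseteq> carrier L" by (auto simp: S_def)
    show "\<zero>\<^bsub>L\<^esub> \<in> S" by (rule zS)
    show add: "x \<oplus>\<^bsub>L\<^esub> y \<in> S" if "x \<in> S" "y \<in> S" for x y
      using that submoduleE(5)[OF P_sub] by (simp add: S_def component_add)
    show smult: "a \<odot>\<^bsub>L\<^esub> x \<in> S" if "a \<in> carrier K" "x \<in> S" for a x
      using that submoduleE(4)[OF P_sub] by (simp add: S_def component_smult)
    show "\<ominus>\<^bsub>L\<^esub> x \<in> S" if "x \<in> S" for x
      using smult[of "\<ominus>\<^bsub>K\<^esub> \<one>\<^bsub>K\<^esub>" x] that by (simp add: smult_l_minus S_def)
  qed
  have SZ: "S \<inter> lie_center L \<subseteq> {\<zero>\<^bsub>L\<^esub>}"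
  proof
    fix x assume x: "x \<in> S \<inter> lie_center L"
    then have "component x g = \<zero>\<^bsub>L\<^esub>" if "g \<in> carrier G" for g
      using PZ[OF that] component_center[OF _ that, of x] that by (auto simp: S_def)
    then show "x \<in> {\<zero>\<^bsub>L\<^esub>}" using components_zero[of x] x by (simp add: S_def)
  qed
  have "\<exists>p\<in>S. \<exists>z\<in>lie_center L. x = p \<oplus>\<^bsub>L\<^esub> z" if "x \<in> carrier L" for x
    using that
  proof (induction x rule: homogeneous_induct)
    case zero
    have "\<zero>\<^bsub>L\<^esub> = \<zero>\<^bsub>L\<^esub> \<oplus>\<^bsub>L\<^esub> \<zero>\<^bsub>L\<^esub>" by simp
    then show ?case using zS submodule_zero_closed[OF center_submodule] by blast
  next
    case (homogeneous g x)
    then show ?case using span PS by blast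
  next
    case (add x y)
    then obtain p z q w where h: "p \<in> S" "z \<in> lie_center L" "x = p \<oplus>\<^bsub>L\<^esub> z"
        "q \<in> S" "w \<in> lie_center L" "y = q \<oplus>\<^bsub>L\<^esub> w" by blast
    then have "x \<oplus>\<^bsub>L\<^esub> y = (p \<oplus>\<^bsub>L\<^esub> q) \<oplus>\<^bsub>L\<^esub> (z \<oplus>\<^bsub>L\<^esub> w)"
      by (simp add: S_def center_carrier M.a_ac)
    then show ?case using h submoduleE(5)[OF S] submoduleE(5)[OF center_submodule] by blast
  qed
  then have "complement_in (lie_center L) (carrier L) S"
    using S SZ unfolding complement_in_def S_def by blast
  then show thesis using PS that by blast
qed

end

section \<open>Two gradings with the same center and central quotient\<close>

lemma (in lie_algebra) quot_grading_mod_center: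
  assumes eq: "quot_grading L (lie_center L) \<Gamma> g = quot_grading L (lie_center L) \<Delta> g"
    and x: "x \<in> \<Gamma> g" "x \<in> carrier L" and \<Delta>: "\<Delta> g \<subseteq> carrier L"
  obtains y z where "y \<in> \<Delta> g" "z \<in> lie_center L" "x = y \<oplus>\<^bsub>L\<^esub> z"
proof -
  have "lie_center L +>\<^bsub>L\<^esub> x \<in> quot_grading L (lie_center L) \<Delta> g"
    using eq x by (auto simp: quot_grading_def)
  then obtain y where y: "y \<in> \<Delta> g" "lie_center L +>\<^bsub>L\<^esub> x = lie_center L +>\<^bsub>L\<^esub> y"
    by (auto simp: quot_grading_def)
  have "x \<in> lie_center L +>\<^bsub>L\<^esub> x"
    unfolding a_r_coset_def'
    using x submodule_zero_closed[OF center_submodule] by (intro UN_I[of "\<zero>\<^bsub>L\<^esub>"]) simp_all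
  then have "x \<in> lie_center L +>\<^bsub>L\<^esub> y" by (simp only: y(2))
  then obtain z where "z \<in> lie_center L" "x = z \<oplus>\<^bsub>L\<^esub> y" by (auto simp: a_r_coset_def')
  then show thesis using that[of y z] y(1) \<Delta> center_carrier by (auto simp: M.a_comm)
qed

theorem corollary28:
  fixes G :: "('g, 'q) monoid_scheme"
    and K :: "('k, 'r) ring_scheme"
    and L :: "('k, 'a, 'm) module_scheme"
    and \<Gamma>\<^sub>1 \<Gamma>\<^sub>2 :: "'g \<Rightarrow> 'a set"
  assumes "group G"
    and "lie_algebra K L"
    and "lie_grading G K L \<Gamma>\<^sub>1"
    and "lie_grading G K L \<Gamma>\<^sub>2"
    and "graded_eq G
           (quot_alg L (lie_center L), quot_grading L (lie_center L) \<Gamma>\<^sub>1)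
           (quot_alg L (lie_center L), quot_grading L (lie_center L) \<Gamma>\<^sub>2)"
    and "graded_eq G
           (subalg L (lie_center L), sub_grading (lie_center L) \<Gamma>\<^sub>1)
           (subalg L (lie_center L), sub_grading (lie_center L) \<Gamma>\<^sub>2)"
  shows "graded_isomorphic G K (L, \<Gamma>\<^sub>1) (L, \<Gamma>\<^sub>2)"
proof -
  interpret A: graded_lie_algebra K L G \<Gamma>\<^sub>1
    using assms by (simp add: graded_lie_algebra_def graded_lie_algebra_axioms_def)
  interpret B: graded_lie_algebra K L G \<Gamma>\<^sub>2
    using assms by (simp add: graded_lie_algebra_def graded_lie_algebra_axioms_def)
  interpret G: group G by (rule assms(1))
  define Z where "Z = lie_center L"
  have Z: "submodule Z K L" unfolding Z_def by (rule A.center_submodule)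
  have Zc: "z \<in> carrier L" if "z \<in> Z" for z using that by (simp add: Z_def A.center_carrier)
  note sub1 = A.part_submodule and sub2 = B.part_submodule
  have Z_eq: "\<Gamma>\<^sub>1 g \<inter> Z = \<Gamma>\<^sub>2 g \<inter> Z" if "g \<in> carrier G" for g
    using assms(6) that by (simp add: graded_eq_def sub_grading_def Z_def)
  have Q_eq: "quot_grading L Z \<Gamma>\<^sub>1 g = quot_grading L Z \<Gamma>\<^sub>2 g" if "g \<in> carrier G" for g
    using assms(5) that by (simp add: graded_eq_def Z_def)
  have to2: "\<exists>y\<in>\<Gamma>\<^sub>2 g. \<exists>z\<in>Z. x = y \<oplus>\<^bsub>L\<^esub> z" if g: "g \<in> carrier G" and x: "x \<in> \<Gamma>\<^sub>1 g" for g x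
    using A.quot_grading_mod_center[OF Q_eq[OF g, unfolded Z_def] x A.part_carrier[OF g x]
        A.submoduleE(1)[OF sub2[OF g]]] unfolding Z_def by blast
  have to1: "\<exists>y\<in>\<Gamma>\<^sub>1 g. \<exists>z\<in>Z. x = y \<oplus>\<^bsub>L\<^esub> z" if g: "g \<in> carrier G" and x: "x \<in> \<Gamma>\<^sub>2 g" for g x
    using A.quot_grading_mod_center[OF Q_eq[OF g, unfolded Z_def, symmetric] x B.part_carrier[OF g x]
        A.submoduleE(1)[OF sub1[OF g]]] unfolding Z_def by blast

  \<comment> \<open>Brackets see their arguments only modulo the center, and modulo it the gradings agree.\<close>
  have bracket_common: "x \<otimes>\<^bsub>L\<^esub> y \<in> \<Gamma>\<^sub>1 (g \<otimes>\<^bsub>G\<^esub> h) \<inter> \<Gamma>\<^sub>2 (g \<otimes>\<^bsub>G\<^esub> h)"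
    if g: "g \<in> carrier G" "h \<in> carrier G" and xy: "x \<in> \<Gamma>\<^sub>1 g" "y \<in> \<Gamma>\<^sub>1 h" for g h x y
  proof -
    obtain x' z where x': "x' \<in> \<Gamma>\<^sub>2 g" "z \<in> Z" "x = x' \<oplus>\<^bsub>L\<^esub> z" using to2 g xy by blast
    obtain y' w where y': "y' \<in> \<Gamma>\<^sub>2 h" "w \<in> Z" "y = y' \<oplus>\<^bsub>L\<^esub> w" using to2 g xy by blast
    have "x \<otimes>\<^bsub>L\<^esub> y = x' \<otimes>\<^bsub>L\<^esub> y'"
      using x' y' g B.part_carrier by (simp add: A.bracket_mod_center Z_def)
    then show ?thesis using A.bracket_part[OF g xy] B.bracket_part[OF g x'(1) y'(1)] by simp
  qed

  \<comment> \<open>Placing one \<open>C\<close> inside both complements will force the exchange to fix \<open>\<Gamma>\<^sub>1 g \<inter> \<Gamma>\<^sub>2 g\<close>.\<close>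
  have "\<exists>C C\<^sub>1 C\<^sub>2. A.complement_in Z (\<Gamma>\<^sub>1 g \<inter> \<Gamma>\<^sub>2 g) C \<and> C \<subseteq> C\<^sub>1 \<and> C \<subseteq> C\<^sub>2 \<and>
      A.complement_in Z (\<Gamma>\<^sub>1 g) C\<^sub>1 \<and> A.complement_in Z (\<Gamma>\<^sub>2 g) C\<^sub>2" if g: "g \<in> carrier G" for g
  proof -
    have D: "submodule (\<Gamma>\<^sub>1 g \<inter> \<Gamma>\<^sub>2 g) K L" using A.submodule_inter[OF sub1[OF g] sub2[OF g]] .
    obtain C where C: "A.complement_in Z (\<Gamma>\<^sub>1 g \<inter> \<Gamma>\<^sub>2 g) C"
      by (rule A.complement_extending[OF A.K.field_axioms A.zero_submodule Z D])
        (use A.submodule_zero_closed[OF D] in auto)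
    note CD = A.complement_inD(1-3)[OF C]
    obtain C\<^sub>1 where C1: "C \<subseteq> C\<^sub>1" "A.complement_in Z (\<Gamma>\<^sub>1 g) C\<^sub>1"
      by (rule A.complement_extending[OF A.K.field_axioms CD(1) Z sub1[OF g]]) (use CD in auto)
    obtain C\<^sub>2 where C2: "C \<subseteq> C\<^sub>2" "A.complement_in Z (\<Gamma>\<^sub>2 g) C\<^sub>2"
      by (rule A.complement_extending[OF A.K.field_axioms CD(1) Z sub2[OF g]]) (use CD in auto)
    show ?thesis using C C1 C2 by blast
  qed
  then obtain P\<^sub>0 P\<^sub>1 P\<^sub>2 where
      P0: "\<And>g. g \<in> carrier G \<Longrightarrow> A.complement_in Z (\<Gamma>\<^sub>1 g \<inter> \<Gamma>\<^sub>2 g) (P\<^sub>0 g)"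
      and P01: "\<And>g. g \<in> carrier G \<Longrightarrow> P\<^sub>0 g \<subseteq> P\<^sub>1 g" and P02: "\<And>g. g \<in> carrier G \<Longrightarrow> P\<^sub>0 g \<subseteq> P\<^sub>2 g"
      and P1: "\<And>g. g \<in> carrier G \<Longrightarrow> A.complement_in Z (\<Gamma>\<^sub>1 g) (P\<^sub>1 g)"
      and P2: "\<And>g. g \<in> carrier G \<Longrightarrow> A.complement_in Z (\<Gamma>\<^sub>2 g) (P\<^sub>2 g)" by metis
  obtain S\<^sub>1 where S1: "A.complement_in Z (carrier L) S\<^sub>1" "\<And>g. g \<in> carrier G \<Longrightarrow> P\<^sub>1 g \<subseteq> S\<^sub>1"
    using A.graded_complement_of_center[of P\<^sub>1] P1 unfolding Z_def by blast
  obtain S\<^sub>2 where S2: "A.complement_in Z (carrier L) S\<^sub>2" "\<And>g. g \<in> carrier G \<Longrightarrow> P\<^sub>2 g \<subseteq> S\<^sub>2"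
    using B.graded_complement_of_center[of P\<^sub>2] P2 unfolding Z_def by blast
  interpret T: two_complements K L Z S\<^sub>1 S\<^sub>2
    by (intro two_complements.intro two_complements_axioms.intro) (fact A.module_axioms Z S1(1) S2(1))+
  interpret T': two_complements K L Z S\<^sub>2 S\<^sub>1
    by (rule T.swap)
  define \<phi> where "\<phi> x = (THE y. T.exch x y)" for x
  have \<phi>_eq: "\<phi> x = y" if "T.exch x y" for x y
    unfolding \<phi>_def using that T.exch_functional by blast
  have \<phi>: "T.exch x (\<phi> x)" if "x \<in> carrier L" for x
    using T.exch_total[OF that] \<phi>_eq by metis
  have \<phi>_add: "\<phi> (x \<oplus>\<^bsub>L\<^esub> y) = \<phi> x \<oplus>\<^bsub>L\<^esub> \<phi> y" if "x \<in> carrier L" "y \<in> carrier L" for x y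
    using that \<phi> \<phi>_eq T.exch_add by blast
  have \<phi>_smult: "\<phi> (a \<odot>\<^bsub>L\<^esub> x) = a \<odot>\<^bsub>L\<^esub> \<phi> x" if "a \<in> carrier K" "x \<in> carrier L" for a x
    using that \<phi> \<phi>_eq T.exch_smult by blast
  have \<phi>_common: "\<phi> x = x" if g: "g \<in> carrier G" and x: "x \<in> \<Gamma>\<^sub>1 g \<inter> \<Gamma>\<^sub>2 g" for g x
  proof -
    obtain c z where cz: "c \<in> P\<^sub>0 g" "z \<in> Z" "x = c \<oplus>\<^bsub>L\<^esub> z"
      using A.complement_inD(4)[OF P0[OF g] x] by blast
    have "c \<in> S\<^sub>1" "c \<in> S\<^sub>2"
      using P01[OF g] P02[OF g] S1(2)[OF g] S2(2)[OF g] cz(1) by blast+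
    then have "T.exch x x" unfolding cz(3) using cz(2) by (intro T.exch_refl)
    then show ?thesis by (rule \<phi>_eq)
  qed

  have "inj_on \<phi> (carrier L)"
    by (rule inj_onI) (metis \<phi> T.exch_sym T'.exch_functional)
  moreover have "\<phi> ` carrier L \<subseteq> carrier L"
    using \<phi> T.exch_carrier by blast
  moreover have "carrier L \<subseteq> \<phi> ` carrier L"
  proof
    fix y assume "y \<in> carrier L"
    then obtain x where "T'.exch y x" using T'.exch_total by blast
    then have "T.exch x y" "x \<in> carrier L" using T'.exch_sym T'.exch_carrier by blast+
    then show "y \<in> \<phi> ` carrier L" using \<phi>_eq by blast
  qed
  ultimately have bij: "bij_betw \<phi> (carrier L) (carrier L)"
    unfolding bij_betw_def by blast

  have \<phi>_bracket_fixed: "\<phi> (x \<otimes>\<^bsub>L\<^esub> y) = x \<otimes>\<^bsub>L\<^esub> y" if "x \<in> carrier L" "y \<in> carrier L" for x y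
  proof -
    have \<phi>0: "\<phi> \<zero>\<^bsub>L\<^esub> = \<zero>\<^bsub>L\<^esub>"
      using \<phi>_common[of "\<one>\<^bsub>G\<^esub>" "\<zero>\<^bsub>L\<^esub>"] A.submodule_zero_closed[OF sub1] A.submodule_zero_closed[OF sub2] by simp
    from that(1) show ?thesis
    proof (induction x rule: A.homogeneous_induct)
      case zero then show ?case using that \<phi>0 by simp
    next
      case (homogeneous g x)
      note x = homogeneous and xc = A.part_carrier[OF homogeneous]
      from that(2) show ?case
      proof (induction y rule: A.homogeneous_induct)
        case zero then show ?case using xc \<phi>0 by simp
      next
        case (homogeneous h y)
        then show ?case using \<phi>_common[of "g \<otimes>\<^bsub>G\<^esub> h"] bracket_common x by simp
      next
        case (add y y')
        then show ?case using xc by (simp add: A.bracket_add_right \<phi>_add A.bracket_closed)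
      qed
    next
      case (add x x')
      then show ?case using that by (simp add: A.bracket_add_left \<phi>_add A.bracket_closed)
    qed
  qed
  have \<phi>_bracket: "\<phi> (x \<otimes>\<^bsub>L\<^esub> y) = \<phi> x \<otimes>\<^bsub>L\<^esub> \<phi> y" if xy: "x \<in> carrier L" "y \<in> carrier L" for x y
  proof -
    obtain z w where "z \<in> Z" "\<phi> x = x \<oplus>\<^bsub>L\<^esub> z" "w \<in> Z" "\<phi> y = y \<oplus>\<^bsub>L\<^esub> w"
      using T.exch_mod_Z[OF \<phi>] xy by metis
    then have "\<phi> x \<otimes>\<^bsub>L\<^esub> \<phi> y = x \<otimes>\<^bsub>L\<^esub> y" using xy by (simp add: A.bracket_mod_center Z_def)
    then show ?thesis using \<phi>_bracket_fixed xy by simp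
  qed

  have part1: "\<exists>p\<in>\<Gamma>\<^sub>1 g \<inter> S\<^sub>1. \<exists>z\<in>Z. x = p \<oplus>\<^bsub>L\<^esub> z" if g: "g \<in> carrier G" and x: "x \<in> \<Gamma>\<^sub>1 g" for g x
    using A.complement_inD(4)[OF P1[OF g] x] A.complement_inD(2)[OF P1[OF g]] S1(2)[OF g] by blast
  have part2: "\<exists>p\<in>\<Gamma>\<^sub>2 g \<inter> S\<^sub>2. \<exists>z\<in>Z. x = p \<oplus>\<^bsub>L\<^esub> z" if g: "g \<in> carrier G" and x: "x \<in> \<Gamma>\<^sub>2 g" for g x
    using A.complement_inD(4)[OF P2[OF g] x] A.complement_inD(2)[OF P2[OF g]] S2(2)[OF g] by blast
  have fwd: "\<exists>y\<in>\<Gamma>\<^sub>2 g. T.exch x y" if g: "g \<in> carrier G" and x: "x \<in> \<Gamma>\<^sub>1 g" for g x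
    by (rule T.exch_part[OF sub1[OF g] sub2[OF g] _ part1[OF g] part2[OF g] to2[OF g] x])
      (use Z_eq[OF g] in auto)
  have bwd: "\<exists>x\<in>\<Gamma>\<^sub>1 g. T'.exch y x" if g: "g \<in> carrier G" and y: "y \<in> \<Gamma>\<^sub>2 g" for g y
    by (rule T'.exch_part[OF sub2[OF g] sub1[OF g] _ part2[OF g] part1[OF g] to1[OF g] y])
      (use Z_eq[OF g] in auto)
  have "\<phi> ` \<Gamma>\<^sub>1 g = \<Gamma>\<^sub>2 g" if g: "g \<in> carrier G" for g
  proof
    show "\<phi> ` \<Gamma>\<^sub>1 g \<subseteq> \<Gamma>\<^sub>2 g" using fwd[OF g] \<phi>_eq by blast
    show "\<Gamma>\<^sub>2 g \<subseteq> \<phi> ` \<Gamma>\<^sub>1 g" using bwd[OF g] T'.exch_sym \<phi>_eq by blast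
  qed
  then show ?thesis
    unfolding graded_isomorphic_def alg_iso_def
    using bij \<phi>_add \<phi>_smult \<phi>_bracket by (intro exI[of _ \<phi>]) simp
qed

end
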